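(* Let $n\ge 2$, let $\Omega\subset\mathbb{R}^n$ be an open set, and let $f,g\in C^1(\Omega;\mathbb{C})$ be functions with simple zeros and a common zero set $\Gamma=\Gamma_f=\Gamma_g$. Then the following statements are equivalent: (i) There exists a non-vanishing continuous function $\varphi\in C^0(\Omega;\mathbb{C})$ such that $f=g\varphi$ on $\Omega$. (ii) $f$ and $g$ are complex linearly related.
   Context: For $f\colon\Omega\to\mathbb{C}$, the zero set is $\Gamma_f=\{\mathbf{a}\in\Omega : f(\mathbf{a})=0\}$. A differentiable function $f\colon\Omega\to\mathbb{C}$ is said to have simple zeros if at each $\mathbf{a}\in\Gamma_f$ the derivative $Df|_{\mathbf{a}}\colon\mathbb{R}^n\to\mathbb{C}\cong\mathbb{R}^2$, considered as a real linear map, has rank 2. Here $\mathbb{C}$ is identified with $\mathbb{R}^2$ via the basis $1,i$. Ratio of derivatives: if $f,g$ have simple zeros and a common zero set $\Gamma$, then for each $\mathbf{a}\in\Gamma$ there is a unique real matrix $\mathbf{A}|_{\mathbf{a}}\in\mathbb{R}^{2\times 2}$ with $Df|_{\mathbf{a}}=\mathbf{A}|_{\mathbf{a}}\,Dg|_{\mathbf{a}}$; it is denoted $\left(\frac{Df}{Dg}\right)_{\mathbf{a}}:=\mathbf{A}|_{\mathbf{a}}$. Complex linearity: two functions $f,g$ with simple zeros and a common zero set $\Gamma$ are complex linearly related if there are functions $u,v\colon\Gamma\to\mathbb{R}$ such that $$\left(\frac{Df}{Dg}\right)_{\mathbf{a}}=\begin{bmatrix}u(\mathbf{a})&-v(\mathbf{a})\\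 v(\mathbf{a})&u(\mathbf{a})\end{bmatrix}\quad\text{for all }\mathbf{a}\in\Gamma.$$ Non-vanishing means nonzero at every point of the domain. *)

theory Defs
  imports "HOL-Analysis.Analysis"
begin

text \<open>Functions on an open set \<Omega> are total functions on \<open>real ^ 'n\<close>; only their values on \<Omega>
  matter, and since \<Omega> is open the derivative at a point of \<Omega> is taken with respect to \<open>at a\<close>.\<close>

definition C1_on :: "(real ^ 'n) set \<Rightarrow> (real ^ 'n \<Rightarrow> complex) \<Rightarrow> bool" where
  "C1_on \<Omega> f \<longleftrightarrow>
     (\<exists>f' :: real ^ 'n \<Rightarrow> ((real ^ 'n) \<Rightarrow>\<^sub>L complex).
        (\<forall>x\<in>\<Omega>. (f has_derivative blinfun_apply (f' x)) (at x)) \<and> continuous_on \<Omega> f')"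

definition zero_set :: "(real ^ 'n) set \<Rightarrow> (real ^ 'n \<Rightarrow> complex) \<Rightarrow> (real ^ 'n) set" where
  "zero_set \<Omega> f = {a \<in> \<Omega>. f a = 0}"

definition simple_zeros :: "(real ^ 'n) set \<Rightarrow> (real ^ 'n \<Rightarrow> complex) \<Rightarrow> bool" where
  "simple_zeros \<Omega> f \<longleftrightarrow>
     (\<forall>x\<in>\<Omega>. f differentiable (at x)) \<and>
     (\<forall>a \<in> zero_set \<Omega> f. dim (range (frechet_derivative f (at a))) = 2)"

definition complex_to_R2 :: "complex \<Rightarrow> real ^ 2" where
  "complex_to_R2 z = vector [Re z, Im z]"

definition deriv_matrix :: "(real ^ 'n \<Rightarrow> complex) \<Rightarrow> real ^ 'n \<Rightarrow> real ^ 'n ^ 2" where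
  "deriv_matrix f a = matrix (complex_to_R2 \<circ> frechet_derivative f (at a))"

text \<open>The matrix below exists and is unique when \<open>f\<close> and \<open>g\<close> are \<open>C\<^sup>1\<close> with simple zeros and the same
  zero set, and \<open>a\<close> lies in that zero set; otherwise the value carries no meaning.\<close>

definition deriv_ratio ::
    "(real ^ 'n \<Rightarrow> complex) \<Rightarrow> (real ^ 'n \<Rightarrow> complex) \<Rightarrow> real ^ 'n \<Rightarrow> real ^ 2 ^ 2" where
  "deriv_ratio f g a = (THE A. deriv_matrix f a = A ** deriv_matrix g a)"

definition complex_linearly_related ::
    "(real ^ 'n) set \<Rightarrow> (real ^ 'n \<Rightarrow> complex) \<Rightarrow> (real ^ 'n \<Rightarrow> complex) \<Rightarrow> bool" where
  "complex_linearly_related \<Gamma> f g \<longleftrightarrow>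
     (\<exists>u v :: real ^ 'n \<Rightarrow> real. \<forall>a\<in>\<Gamma>.
        deriv_ratio f g a = vector [vector [u a, - v a],
                                    vector [v a,   u a]])"

end

theory Submission
  imports Defs
begin

text \<open>The proof rests on a quantitative form of the statement that the zero set of a submersion \<open>g\<close>
  is as large as its linearization predicts: near a zero \<open>a\<close> of \<open>g\<close> with surjective derivative,
  every point \<open>x\<close> has a zero of \<open>g\<close> within distance \<open>C |g x|\<close>, where \<open>C\<close> depends only on a right
  inverse of \<open>Dg(a)\<close> (\<open>zero_at_distance_bounded_by_value\<close>). If a \<open>C\<^sup>1\<close> function \<open>h\<close>
  vanishes wherever \<open>g\<close> does, the mean value inequality between \<open>x\<close> and that zero gives
  \<open>|h x| \<le> (|Dh(a)| + \<epsilon>) C |g x|\<close> near \<open>a\<close>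
  (\<open>bounded_by_submersion_with_smaller_zero_set\<close>). This estimate is used twice.

  With \<open>h = f\<close> it says that \<open>f\<close> is locally bounded by a multiple of \<open>g\<close>; passing to directional
  derivatives, \<open>Df(a)\<close> is bounded by a multiple of \<open>Dg(a)\<close>, so \<open>ker Dg(a) \<subseteq> ker Df(a)\<close>. Hence the matrix
  \<open>Df/Dg\<close> exists, and it is unique because \<open>Dg(a)\<close> is onto. It has the form demanded by
  complex linearity exactly when \<open>Df(a) = c Dg(a)\<close> for the complex number \<open>c = u + iv\<close>.

  With \<open>h = f - c(a) g\<close>, whose derivative at \<open>a\<close> is zero when \<open>f\<close> and \<open>g\<close> are complex linearly
  related, it says \<open>f - c(a) g = o(|g|)\<close>. So \<open>f / g\<close>, where it is defined, tends to \<open>c(a)\<close> at \<open>a\<close>, and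
  extending it by \<open>c\<close> to the zero set gives the continuous factor
  (\<open>continuous_quotient_of_linearly_related\<close>). Its values on the zero set are nonzero because
  \<open>Df(a) \<noteq> 0\<close>.

  Conversely, if \<open>f = g \<phi>\<close> with \<open>\<phi>\<close> merely continuous, then \<open>f - \<phi>(a) g = (\<phi> - \<phi>(a)) g = o(|g|)\<close>,
  and comparing directional derivatives yields \<open>Df(a) = \<phi>(a) Dg(a)\<close>
  (\<open>derivative_of_continuous_multiple\<close>).\<close>

section \<open>Zeros of a submersion near points where it is small\<close>

text \<open>Continuity of the derivative makes the linear approximation uniform over pairs of points, not
  only between a point and the centre; this is the form a contraction argument needs.\<close>

lemma C1_imp_strict_derivative:
  fixes g :: "'a::real_normed_vector \<Rightarrow> 'b::real_normed_vector"
  assumes "open \<Omega>" "a \<in> \<Omega>"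
    and der: "\<And>x. x \<in> \<Omega> \<Longrightarrow> (g has_derivative blinfun_apply (g' x)) (at x)"
    and cont: "continuous_on \<Omega> g'"
    and "\<epsilon> > 0"
  obtains r where "r > 0" "ball a r \<subseteq> \<Omega>"
    "\<And>x z. x \<in> ball a r \<Longrightarrow> z \<in> ball a r \<Longrightarrow>
       norm (g x - g z - g' a (x - z)) \<le> \<epsilon> * norm (x - z)"
proof -
  have "isCont g' a"
    using cont \<open>open \<Omega>\<close> \<open>a \<in> \<Omega>\<close> by (simp add: continuous_on_eq_continuous_at)
  then obtain s where s: "s > 0" "\<And>x. dist x a < s \<Longrightarrow> dist (g' x) (g' a) < \<epsilon>"
    using \<open>\<epsilon> > 0\<close> unfolding continuous_at_eps_delta by metis
  obtain t where t: "t > 0" "ball a t \<subseteq> \<Omega>"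
    using \<open>open \<Omega>\<close> \<open>a \<in> \<Omega>\<close> open_contains_ball by blast
  define r where "r = min s t"
  show thesis
  proof
    show "r > 0" "ball a r \<subseteq> \<Omega>"
      using s t by (auto simp: r_def)
    fix x z assume xz: "x \<in> ball a r" "z \<in> ball a r"
    have "norm ((g x - g' a x) - (g z - g' a z)) \<le> \<epsilon> * norm (x - z)"
    proof (rule differentiable_bound[where S = "ball a r" and f' = "\<lambda>y. blinfun_apply (g' y - g' a)"])
      fix y assume y: "y \<in> ball a r"
      then have "y \<in> \<Omega>" and small: "dist (g' y) (g' a) < \<epsilon>"
        using t s(2)[of y] by (auto simp: r_def dist_commute)
      then have "(g has_derivative blinfun_apply (g' y)) (at y within ball a r)"
        using der has_derivative_at_withinI by blast
      then show "((\<lambda>y. g y - g' a y) has_derivative blinfun_apply (g' y - g' a)) (at y within ball a r)"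
        by (auto intro!: derivative_eq_intros simp: blinfun.diff_left)
      show "onorm (blinfun_apply (g' y - g' a)) \<le> \<epsilon>"
        using small by (simp add: dist_norm norm_blinfun.rep_eq)
    qed (use xz in auto)
    then show "norm (g x - g z - g' a (x - z)) \<le> \<epsilon> * norm (x - z)"
      by (simp add: blinfun.diff_right algebra_simps)
  qed
qed

text \<open>Newton's iteration with the fixed slope \<open>L\<close>, started at \<open>x\<close>: the first step has
  length at most \<open>|R| |g x|\<close> and each further step is at most half the previous one, so the
  iterates stay within twice that distance of \<open>x\<close> and converge to a zero of \<open>g\<close>.
  Only a right inverse of \<open>L\<close> is available, so the iteration map is written relative to \<open>x\<close>; this
  keeps all iterates in \<open>x + range R\<close>, on which the fixed point equation forces \<open>g z = 0\<close>.\<close>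

lemma zero_at_distance_bounded_by_value:
  fixes g :: "'a::banach \<Rightarrow> 'b::real_normed_vector"
    and L :: "'a \<Rightarrow>\<^sub>L 'b" and R :: "'b \<Rightarrow>\<^sub>L 'a"
  assumes "\<epsilon> * norm R \<le> 1 / 2"
    and LR: "\<And>y. L (R y) = y"
    and strict: "\<And>y z. y \<in> cball x (2 * norm R * norm (g x)) \<Longrightarrow>
         z \<in> cball x (2 * norm R * norm (g x)) \<Longrightarrow>
         norm (g y - g z - L (y - z)) \<le> \<epsilon> * norm (y - z)"
  shows "\<exists>z \<in> cball x (2 * norm R * norm (g x)). g z = 0"
proof -
  define \<rho> where "\<rho> = 2 * norm R * norm (g x)"
  define T where "T = (\<lambda>z. x - R (g z - L (z - x)))"
  have "\<rho> \<ge> 0" by (simp add: \<rho>_def)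
  have contraction: "norm (R (g y - g z - L (y - z))) \<le> 1 / 2 * norm (y - z)"
    if "y \<in> cball x \<rho>" "z \<in> cball x \<rho>" for y z
  proof -
    have "norm (R (g y - g z - L (y - z))) \<le> norm R * norm (g y - g z - L (y - z))"
      by (rule norm_blinfun)
    also have "\<dots> \<le> norm R * (\<epsilon> * norm (y - z))"
      using strict that by (intro mult_left_mono) (auto simp: \<rho>_def)
    also have "\<dots> = (\<epsilon> * norm R) * norm (y - z)" by simp
    also have "\<dots> \<le> 1 / 2 * norm (y - z)"
      by (intro mult_right_mono assms) auto
    finally show ?thesis .
  qed
  have "\<exists>!z. z \<in> cball x \<rho> \<and> T z = z"
  proof (rule Banach_fix[where c = "1 / 2"])
    show "complete (cball x \<rho>)" by (simp add: complete_eq_closed)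
    show "cball x \<rho> \<noteq> {}" using \<open>\<rho> \<ge> 0\<close> by auto
    show "T ` cball x \<rho> \<subseteq> cball x \<rho>"
    proof clarify
      fix z assume z: "z \<in> cball x \<rho>"
      have "x - T z = R (g z - g x - L (z - x)) + R (g x)"
        by (simp add: T_def flip: blinfun.add_right)
      then have "norm (x - T z) \<le> norm (R (g z - g x - L (z - x))) + norm (R (g x))"
        by (simp add: norm_triangle_ineq)
      also have "\<dots> \<le> 1 / 2 * norm (z - x) + norm R * norm (g x)"
        using contraction[OF z, of x] \<open>\<rho> \<ge> 0\<close> norm_blinfun[of R "g x"] by (intro add_mono) auto
      also have "\<dots> \<le> 1 / 2 * \<rho> + 1 / 2 * \<rho>"
        using z by (intro add_mono) (auto simp: \<rho>_def dist_norm norm_minus_commute)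
      finally show "T z \<in> cball x \<rho>" by (simp add: dist_norm)
    qed
    show "dist (T y) (T z) \<le> 1 / 2 * dist y z" if "y \<in> cball x \<rho>" "z \<in> cball x \<rho>" for y z
    proof -
      have "T y - T z = - R (g y - g z - L (y - z))"
        by (simp add: T_def blinfun.diff_right)
      then show ?thesis using contraction[OF that] by (simp add: dist_norm)
    qed
  qed auto
  then obtain z where z: "z \<in> cball x \<rho>" "T z = z" by blast
  then have "z - x = - R (g z - L (z - x))" by (simp add: T_def algebra_simps)
  \<comment> \<open>Applying \<open>L\<close> cancels \<open>R\<close> on the right, and \<open>L (z - x)\<close> then cancels from both sides.\<close>
  then have "L (z - x) = L (- R (g z - L (z - x)))" by simp
  then have "g z = 0" by (simp add: blinfun.minus_right LR)
  then show ?thesis using z by (auto simp: \<rho>_def)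
qed

text \<open>Compare \<open>f x\<close> with the value \<open>f z = 0\<close> at a nearby zero \<open>z\<close> of \<open>g\<close>, which lies at distance
  at most \<open>2 |R| |g x|\<close>. The factor \<open>|f' a| + \<epsilon>\<close> is a Lipschitz constant for \<open>f\<close> near \<open>a\<close>; it is
  kept explicit because the case \<open>f' a = 0\<close> is what yields \<open>f = o(|g|)\<close>.\<close>

lemma bounded_by_submersion_with_smaller_zero_set:
  fixes f :: "'a::banach \<Rightarrow> 'c::real_normed_vector" and g :: "'a \<Rightarrow> 'b::real_normed_vector"
    and R :: "'b \<Rightarrow>\<^sub>L 'a"
  assumes "open \<Omega>" "a \<in> \<Omega>"
    and derf: "\<And>x. x \<in> \<Omega> \<Longrightarrow> (f has_derivative blinfun_apply (f' x)) (at x)"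
    and contf: "continuous_on \<Omega> f'"
    and derg: "\<And>x. x \<in> \<Omega> \<Longrightarrow> (g has_derivative blinfun_apply (g' x)) (at x)"
    and contg: "continuous_on \<Omega> g'"
    and zeros: "\<And>x. x \<in> \<Omega> \<Longrightarrow> g x = 0 \<Longrightarrow> f x = 0"
    and "g a = 0"
    and R: "\<And>y. g' a (R y) = y"
    and "\<epsilon> > 0"
  shows "\<forall>\<^sub>F x in nhds a. norm (f x) \<le> (norm (f' a) + \<epsilon>) * (2 * norm R) * norm (g x)"
proof -
  define \<eta> where "\<eta> = 1 / (2 * (norm R + 1))"
  \<comment> \<open>The summand 1 avoids division by zero when \<open>R = 0\<close>.\<close>
  have "norm R + 1 > 0" by (simp add: add_nonneg_pos)
  then have \<eta>: "\<eta> > 0" "\<eta> * norm R \<le> 1 / 2"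
    by (auto simp: \<eta>_def field_simps)
  obtain r where r: "r > 0" "ball a r \<subseteq> \<Omega>"
    "\<And>x z. x \<in> ball a r \<Longrightarrow> z \<in> ball a r \<Longrightarrow>
       norm (f x - f z - f' a (x - z)) \<le> \<epsilon> * norm (x - z)"
    using C1_imp_strict_derivative[OF assms(1,2) derf contf \<open>\<epsilon> > 0\<close>] by metis
  obtain s where s: "s > 0" "ball a s \<subseteq> \<Omega>"
    "\<And>x z. x \<in> ball a s \<Longrightarrow> z \<in> ball a s \<Longrightarrow>
       norm (g x - g z - g' a (x - z)) \<le> \<eta> * norm (x - z)"
    using C1_imp_strict_derivative[OF assms(1,2) derg contg \<eta>(1)] by metis
  \<comment> \<open>Since \<open>g a = 0\<close>, both \<open>x\<close> and the ball in which its zero is found lie close to \<open>a\<close>.\<close>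
  have "isCont g a" using derg[OF \<open>a \<in> \<Omega>\<close>] has_derivative_continuous by blast
  then have "(g \<longlongrightarrow> g a) (nhds a)"
    unfolding isCont_def tendsto_at_iff_tendsto_nhds .
  then have "((\<lambda>x. dist a x + 2 * norm R * norm (g x)) \<longlongrightarrow> dist a a + 2 * norm R * norm (g a)) (nhds a)"
    by (intro tendsto_intros filterlim_ident)
  then have "\<forall>\<^sub>F x in nhds a. dist a x + 2 * norm R * norm (g x) < min r s"
    using r s \<open>g a = 0\<close> by (intro order_tendstoD(2)) auto
  then show ?thesis
  proof eventually_elim
    case (elim x)
    have sub: "cball x (2 * norm R * norm (g x)) \<subseteq> ball a (min r s)"
    proof
      fix y assume "y \<in> cball x (2 * norm R * norm (g x))"
      then show "y \<in> ball a (min r s)"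
        using elim dist_triangle[of a y x] by auto
    qed
    then obtain z where z: "z \<in> cball x (2 * norm R * norm (g x))" "g z = 0"
      using zero_at_distance_bounded_by_value[OF \<eta>(2) R, of x g] s(3) by (auto simp: subset_iff)
    have "x \<in> cball x (2 * norm R * norm (g x))" by simp
    then have "x \<in> ball a (min r s)" "z \<in> ball a (min r s)" using sub z by blast+
    then have "x \<in> ball a r" "z \<in> ball a r" by simp_all
    note near = r(3)[OF this]
    have "f z = 0" using zeros z \<open>z \<in> ball a r\<close> r by blast
    then have "norm (f x) \<le> norm (f' a (x - z)) + \<epsilon> * norm (x - z)"
      using near norm_triangle_sub[of "f x" "f' a (x - z)"] by simp
    also have "\<dots> \<le> norm (f' a) * norm (x - z) + \<epsilon> * norm (x - z)"
      by (intro add_right_mono norm_blinfun)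
    also have "\<dots> = (norm (f' a) + \<epsilon>) * norm (x - z)" by (simp add: algebra_simps)
    also have "\<dots> \<le> (norm (f' a) + \<epsilon>) * (2 * norm R * norm (g x))"
      using z \<open>\<epsilon> > 0\<close> by (intro mult_left_mono) (auto simp: dist_norm)
    finally show ?case by (simp add: mult.assoc)
  qed
qed

section \<open>Comparison of derivatives at a common zero\<close>

text \<open>Divide the hypothesis at \<open>x = a + t v\<close> by \<open>|t|\<close> and let \<open>t\<close> tend to 0.\<close>

lemma derivative_bound_of_function_bound:
  fixes f :: "'a::real_normed_vector \<Rightarrow> 'c::real_normed_vector"
    and g :: "'a \<Rightarrow> 'b::real_normed_vector"
  assumes f: "(f has_derivative F) (at a)" and g: "(g has_derivative G) (at a)"
    and "f a = 0" "g a = 0"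
    and bound: "\<forall>\<^sub>F x in nhds a. norm (f x) \<le> K * norm (g x)"
  shows "norm (F v) \<le> K * norm (G v)"
proof -
  have *: "((\<lambda>t. norm (h (a + t *\<^sub>R v)) / \<bar>t\<bar>) \<longlongrightarrow> norm (H v)) (at (0::real))"
    if h: "(h has_derivative H) (at a)" and "h a = 0"
    for h :: "'a \<Rightarrow> 'd::real_normed_vector" and H
  proof -
    have "linear H" using h has_derivative_linear by blast
    have "((\<lambda>t. a + t *\<^sub>R v) has_derivative (\<lambda>t. t *\<^sub>R v)) (at 0)"
      by (auto intro!: derivative_eq_intros)
    then have "((\<lambda>t. h (a + t *\<^sub>R v)) has_derivative (\<lambda>t. H (t *\<^sub>R v))) (at 0)"
      by (rule has_derivative_compose[where g = h]) (use h in simp)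
    then have "((\<lambda>t. h (a + t *\<^sub>R v)) has_vector_derivative H v) (at 0)"
      by (simp add: has_vector_derivative_def linear_cmul[OF \<open>linear H\<close>])
    then have "((\<lambda>t. norm (h (a + t *\<^sub>R v) - t *\<^sub>R H v) / norm t) \<longlongrightarrow> 0) (at 0)"
      using \<open>h a = 0\<close> by (simp add: has_vector_derivative_def has_derivative_at)
    moreover have "\<forall>\<^sub>F t in at (0::real). norm (h (a + t *\<^sub>R v) - t *\<^sub>R H v) / norm t
        = norm (h (a + t *\<^sub>R v) /\<^sub>R t - H v)"
    proof (rule eventually_mono[OF eventually_neq_at_within[of 0]])
      fix t :: real assume "t \<noteq> 0"
      then have "h (a + t *\<^sub>R v) /\<^sub>R t - H v = (h (a + t *\<^sub>R v) - t *\<^sub>R H v) /\<^sub>R t"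
        by (simp add: scaleR_diff_right)
      then show "norm (h (a + t *\<^sub>R v) - t *\<^sub>R H v) / norm t
          = norm (h (a + t *\<^sub>R v) /\<^sub>R t - H v)"
        by (simp add: divide_inverse mult.commute)
    qed
    ultimately have "((\<lambda>t. norm (h (a + t *\<^sub>R v) /\<^sub>R t - H v)) \<longlongrightarrow> 0) (at 0)"
      by (rule Lim_transform_eventually)
    then have "((\<lambda>t. h (a + t *\<^sub>R v) /\<^sub>R t) \<longlongrightarrow> H v) (at 0)"
      by (simp add: tendsto_norm_zero_iff LIM_zero_iff)
    then have "((\<lambda>t. norm (h (a + t *\<^sub>R v) /\<^sub>R t)) \<longlongrightarrow> norm (H v)) (at 0)"
      by (rule tendsto_norm)
    then show ?thesis by (simp add: divide_inverse mult.commute)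
  qed
  have "((\<lambda>t. a + t *\<^sub>R v) \<longlongrightarrow> a + 0 *\<^sub>R v) (at (0::real))"
    by (intro tendsto_intros)
  then have "filterlim (\<lambda>t. a + t *\<^sub>R v) (nhds a) (at (0::real))" by simp
  then have "\<forall>\<^sub>F t in at (0::real). norm (f (a + t *\<^sub>R v)) \<le> K * norm (g (a + t *\<^sub>R v))"
    by (rule eventually_compose_filterlim[OF bound])
  then have "\<forall>\<^sub>F t in at (0::real).
      norm (f (a + t *\<^sub>R v)) / \<bar>t\<bar> \<le> K * (norm (g (a + t *\<^sub>R v)) / \<bar>t\<bar>)"
    by eventually_elim (metis abs_ge_zero divide_right_mono times_divide_eq_right)
  then show ?thesis
    by (rule tendsto_le[OF _ tendsto_mult_left[OF *[OF g \<open>g a = 0\<close>]] *[OF f \<open>f a = 0\<close>], rotated]) simp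
qed

section \<open>The matrix ratio of two derivatives\<close>

lemma linear_complex_to_R2: "linear complex_to_R2"
  by (rule linearI) (auto simp: complex_to_R2_def vec_eq_iff forall_2)

lemma complex_to_R2_eq_iff: "complex_to_R2 z = complex_to_R2 w \<longleftrightarrow> z = w"
  by (auto simp: complex_to_R2_def vec_eq_iff forall_2 complex_eq_iff)

lemma surj_complex_to_R2: "surj complex_to_R2"
proof (rule surjI)
  show "complex_to_R2 (Complex (y $ 1) (y $ 2)) = y" for y
    by (simp add: complex_to_R2_def vec_eq_iff forall_2)
qed

text \<open>The matrices in the definition of complex linearity are those of multiplication by a
  complex number.\<close>

lemma complex_mult_as_matrix:
  "vector [vector [u, - v], vector [v, u]] *v complex_to_R2 z = complex_to_R2 (Complex u v * z)"
  by (simp add: complex_to_R2_def vec_eq_iff forall_2 matrix_vector_mult_def sum_2)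

lemma deriv_matrix_works:
  assumes "(f has_derivative F) (at a)"
  shows "deriv_matrix f a *v w = complex_to_R2 (F w)"
proof -
  have "frechet_derivative f (at a) = F"
    using assms frechet_derivative_at by metis
  moreover have "linear F" using assms has_derivative_linear by blast
  ultimately show ?thesis
    using linear_compose[OF \<open>linear F\<close> linear_complex_to_R2]
    by (simp add: deriv_matrix_def matrix_works)
qed

lemma deriv_matrix_eq_iff:
  assumes "(f has_derivative F) (at a)" "(g has_derivative G) (at a)"
  shows "deriv_matrix f a = A ** deriv_matrix g a \<longleftrightarrow>
    (\<forall>w. complex_to_R2 (F w) = A *v complex_to_R2 (G w))"
  by (simp add: matrix_eq deriv_matrix_works[OF assms(1)] deriv_matrix_works[OF assms(2)]
      flip: matrix_vector_mul_assoc)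

text \<open>Surjectivity of \<open>G\<close> makes the ratio unique, so the definite description in
  \<open>deriv_ratio\<close> is determined by any solution.\<close>

lemma deriv_ratio_eqI:
  assumes f: "(f has_derivative F) (at a)" and g: "(g has_derivative G) (at a)"
    and "surj G"
    and A: "\<And>w. complex_to_R2 (F w) = A *v complex_to_R2 (G w)"
  shows "deriv_ratio f g a = A"
  unfolding deriv_ratio_def deriv_matrix_eq_iff[OF f g]
proof (rule the_equality)
  fix B assume "\<forall>w. complex_to_R2 (F w) = B *v complex_to_R2 (G w)"
  then have "B *v complex_to_R2 (G w) = A *v complex_to_R2 (G w)" for w
    using A by metis
  then show "B = A"
    using \<open>surj G\<close> surj_complex_to_R2 unfolding matrix_eq by (metis surjD)
qed (use A in blast)

text \<open>Existence of the ratio: as \<open>F\<close> kills the kernel of \<open>G\<close>, it factors through \<open>G\<close> as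
  \<open>F = (F \<circ> R) \<circ> G\<close> for any right inverse \<open>R\<close> of \<open>G\<close>.\<close>

lemma deriv_ratio_works:
  assumes f: "(f has_derivative F) (at a)" and g: "(g has_derivative G) (at a)"
    and "surj G"
    and ker: "\<And>w. G w = 0 \<Longrightarrow> F w = 0"
  shows "complex_to_R2 (F w) = deriv_ratio f g a *v complex_to_R2 (G w)"
proof -
  have linF: "linear F" and linG: "linear G" using f g has_derivative_linear by blast+
  obtain R where R: "linear R" "G \<circ> R = id"
    using linear_surjective_right_inverse[OF linG \<open>surj G\<close>] by blast
  obtain S where S: "linear S" "S \<circ> complex_to_R2 = id"
    using linear_injective_left_inverse[OF linear_complex_to_R2] complex_to_R2_eq_iff
    by (auto simp: inj_def)
  define A where "A = matrix (complex_to_R2 \<circ> F \<circ> R \<circ> S)"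
  have "linear (complex_to_R2 \<circ> F \<circ> R \<circ> S)"
    by (intro linear_compose linear_complex_to_R2 linF R S)
  then have A: "A *v complex_to_R2 z = complex_to_R2 (F (R z))" for z
    using S by (simp add: A_def matrix_works pointfree_idE)
  have *: "complex_to_R2 (F w) = A *v complex_to_R2 (G w)" for w
  proof -
    have "G (w - R (G w)) = 0" using R by (simp add: linear_diff[OF linG] pointfree_idE)
    then have "F w = F (R (G w))" using ker linear_diff[OF linF] by fastforce
    then show ?thesis using A by simp
  qed
  then show ?thesis using deriv_ratio_eqI[OF f g \<open>surj G\<close>] by metis
qed

section \<open>Continuous factors and complex linear relations\<close>

text \<open>The product rule is not applicable, as \<open>\<phi>\<close> need not be differentiable. Instead
  \<open>f - \<phi>(a) g = (\<phi> - \<phi>(a)) g\<close> is bounded by \<open>\<epsilon> |g|\<close> near \<open>a\<close> for every \<open>\<epsilon> > 0\<close>, and this bound passes to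
  the derivatives.\<close>

lemma derivative_of_continuous_multiple:
  fixes f g :: "'a::real_normed_vector \<Rightarrow> complex"
  assumes f: "(f has_derivative F) (at a)" and g: "(g has_derivative G) (at a)"
    and "f a = 0" "g a = 0"
    and "isCont \<phi> a" and eq: "\<forall>\<^sub>F x in nhds a. f x = g x * \<phi> x"
  shows "F w = \<phi> a * G w"
proof -
  have h: "((\<lambda>x. f x - \<phi> a * g x) has_derivative (\<lambda>w. F w - \<phi> a * G w)) (at a)"
    by (intro has_derivative_diff has_derivative_mult_right f g)
  have bound: "norm (F w - \<phi> a * G w) \<le> \<epsilon> * norm (G w)" if "\<epsilon> > 0" for \<epsilon>
  proof (rule derivative_bound_of_function_bound[OF h g])
    have "\<forall>\<^sub>F x in nhds a. dist (\<phi> x) (\<phi> a) < \<epsilon>"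
      using \<open>isCont \<phi> a\<close> \<open>\<epsilon> > 0\<close>
      unfolding isCont_def tendsto_at_iff_tendsto_nhds by (rule tendstoD)
    with eq show "\<forall>\<^sub>F x in nhds a. norm (f x - \<phi> a * g x) \<le> \<epsilon> * norm (g x)"
    proof eventually_elim
      case (elim x)
      then have "norm (f x - \<phi> a * g x) = norm (\<phi> x - \<phi> a) * norm (g x)"
        by (simp add: algebra_simps flip: norm_mult)
      also have "\<dots> \<le> \<epsilon> * norm (g x)"
        using elim by (intro mult_right_mono) (auto simp: dist_norm)
      finally show ?case .
    qed
  qed (use \<open>f a = 0\<close> \<open>g a = 0\<close> in auto)
  have "((\<lambda>\<epsilon>. \<epsilon> * norm (G w)) \<longlongrightarrow> 0 * norm (G w)) (at_right 0)"
    by (intro tendsto_intros)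
  moreover have "\<forall>\<^sub>F \<epsilon> in at_right 0. norm (F w - \<phi> a * G w) \<le> \<epsilon> * norm (G w)"
    using bound by (auto simp: eventually_at_right_less intro: eventually_mono[OF eventually_at_right_less])
  ultimately have "norm (F w - \<phi> a * G w) \<le> 0 * norm (G w)"
    by (rule tendsto_lowerbound) auto
  then show ?thesis by simp
qed

lemma simple_zeros_surj:
  assumes "simple_zeros \<Omega> f" "a \<in> zero_set \<Omega> f" "(f has_derivative F) (at a)"
  shows "surj F"
proof -
  have "frechet_derivative f (at a) = F"
    using assms(3) frechet_derivative_at by metis
  then have "dim (range F) = DIM(complex)" using assms by (auto simp: simple_zeros_def)
  then have "span (range F) = UNIV" by (simp only: dim_eq_full)
  moreover have "subspace (range F)"
    using has_derivative_linear[OF assms(3)] linear_subspace_image subspace_UNIV by blast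
  ultimately show ?thesis using span_eq_iff by blast
qed

text \<open>At a zero \<open>a\<close> two kinds of nearby points have to be controlled. Off the zero set,
  \<open>h = f - c(a) g\<close> has vanishing derivative at \<open>a\<close>, so \<open>h = o(|g|)\<close>, which is the claim for \<open>f / g\<close>.
  On the zero set, \<open>c\<close> is recovered from the continuous derivatives as a quotient
  \<open>f' x w / g' x w\<close> in a direction \<open>w\<close> fixed so that \<open>g' a w \<noteq> 0\<close>.\<close>

lemma continuous_quotient_of_linearly_related:
  fixes f g :: "'a::banach \<Rightarrow> complex"
  assumes "open \<Omega>"
    and derf: "\<And>x. x \<in> \<Omega> \<Longrightarrow> (f has_derivative blinfun_apply (f' x)) (at x)"
    and contf: "continuous_on \<Omega> f'"
    and derg: "\<And>x. x \<in> \<Omega> \<Longrightarrow> (g has_derivative blinfun_apply (g' x)) (at x)"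
    and contg: "continuous_on \<Omega> g'"
    and zeros: "\<And>x. x \<in> \<Omega> \<Longrightarrow> f x = 0 \<longleftrightarrow> g x = 0"
    and right_inverse: "\<And>a. a \<in> \<Omega> \<Longrightarrow> g a = 0 \<Longrightarrow> \<exists>R::complex \<Rightarrow>\<^sub>L 'a. \<forall>y. g' a (R y) = y"
    and c: "\<And>a w. a \<in> \<Omega> \<Longrightarrow> g a = 0 \<Longrightarrow> f' a w = c a * g' a w"
  shows "continuous_on \<Omega> (\<lambda>x. if g x = 0 then c x else f x / g x)"
    (is "continuous_on \<Omega> ?\<phi>")
proof -
  have contval: "isCont f x" "isCont g x" if "x \<in> \<Omega>" for x
    using derf[OF that] derg[OF that] has_derivative_continuous by blast+
  have "isCont ?\<phi> a" if "a \<in> \<Omega>" for a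
  proof (cases "g a = 0")
    case False
    have "isCont (\<lambda>x. f x / g x) a"
      using contval[OF that] False by (intro continuous_intros)
    moreover have "\<forall>\<^sub>F x in nhds a. g x \<noteq> 0"
      using contval(2)[OF that] False
      by (intro tendsto_imp_eventually_ne) (auto simp: tendsto_nhds_iff isCont_def)
    then have "\<forall>\<^sub>F x in nhds a. ?\<phi> x = f x / g x"
      by eventually_elim simp
    ultimately show ?thesis
      by (subst isCont_cong)
  next
    case True
    obtain R :: "complex \<Rightarrow>\<^sub>L 'a" where R: "\<And>y. g' a (R y) = y"
      using right_inverse[OF \<open>a \<in> \<Omega>\<close> True] by blast
    define w where "w = R 1"
    have w: "g' a w = 1" by (simp add: w_def R)
    have contf': "isCont f' a" and contg': "isCont g' a"
      using contf contg \<open>open \<Omega>\<close> that by (auto simp: continuous_on_eq_continuous_at)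
    have in_\<Omega>: "\<forall>\<^sub>F x in nhds a. x \<in> \<Omega>"
      using \<open>open \<Omega>\<close> that by (rule eventually_nhds_in_open)
    have "\<forall>\<^sub>F x in nhds a. dist (?\<phi> x) (c a) < \<epsilon>" if "\<epsilon> > 0" for \<epsilon>
    proof -
      have lim: "((\<lambda>x. blinfun_apply (g' x) w) \<longlongrightarrow> g' a w) (nhds a)"
        "((\<lambda>x. blinfun_apply (f' x) w) \<longlongrightarrow> f' a w) (nhds a)"
        using contf' contg' by (auto intro!: tendsto_intros simp: tendsto_at_iff_tendsto_nhds isCont_def)
      have "((\<lambda>x. f' x w / g' x w) \<longlongrightarrow> f' a w / g' a w) (nhds a)"
        using w by (intro tendsto_divide lim) simp
      then have "((\<lambda>x. f' x w / g' x w) \<longlongrightarrow> c a) (nhds a)"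
        using w c[OF \<open>a \<in> \<Omega>\<close> True] by simp
      then have near1: "\<forall>\<^sub>F x in nhds a. dist (f' x w / g' x w) (c a) < \<epsilon>"
        using \<open>\<epsilon> > 0\<close> by (rule tendstoD)
      have near2: "\<forall>\<^sub>F x in nhds a. g' x w \<noteq> 0"
        using lim(1) w by (intro tendsto_imp_eventually_ne) auto
      \<comment> \<open>The constant \<open>\<delta>\<close> is chosen to give \<open>\<delta> * (2 |R|) < \<epsilon>\<close>, the bound on \<open>|h| / |g|\<close> obtained below.\<close>
      define h where "h = (\<lambda>x. f x - c a * g x)"
      define h' where "h' = (\<lambda>x. f' x - (blinfun_mult_right (c a) o\<^sub>L g' x))"
      define \<delta> where "\<delta> = \<epsilon> / (4 * (norm R + 1))"
      have "norm R + 1 > 0" by (simp add: add_nonneg_pos)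
      then have "\<delta> > 0" and \<delta>: "\<delta> * (2 * norm R) < \<epsilon>"
        using \<open>\<epsilon> > 0\<close> by (auto simp: \<delta>_def field_simps add_strict_increasing)
      have "h' a = 0"
        using c[OF \<open>a \<in> \<Omega>\<close> True] 
        by (intro blinfun_eqI) (simp add: h'_def blinfun.diff_left blinfun_mult_right.rep_eq)
      have "\<forall>\<^sub>F x in nhds a. norm (h x) \<le> (norm (h' a) + \<delta>) * (2 * norm R) * norm (g x)"
      proof (rule bounded_by_submersion_with_smaller_zero_set[OF \<open>open \<Omega>\<close> \<open>a \<in> \<Omega>\<close> _ _ derg contg])
        fix x assume "x \<in> \<Omega>"
        then show "(h has_derivative blinfun_apply (h' x)) (at x)"
          unfolding h_def using derf derg
          by (auto intro!: derivative_eq_intros simp: h'_def blinfun.diff_left blinfun_mult_right.rep_eq)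
        show "g x = 0 \<Longrightarrow> h x = 0" using zeros[OF \<open>x \<in> \<Omega>\<close>] by (simp add: h_def)
      next
        show "continuous_on \<Omega> h'"
          unfolding h'_def by (intro continuous_intros contf contg)
      qed (use True R \<open>\<delta> > 0\<close> in auto)
      then show ?thesis
        using near1 near2 in_\<Omega>
      proof eventually_elim
        case (elim x)
        show ?case
        proof (cases "g x = 0")
          case True
          then show ?thesis using c[OF \<open>x \<in> \<Omega>\<close> True, of w] elim by simp
        next
          case False
          have "norm (f x / g x - c a) = norm (h x) / norm (g x)"
            using False by (simp add: h_def field_simps flip: norm_divide)
          also have "\<dots> \<le> \<delta> * (2 * norm R)"
            using elim False \<open>h' a = 0\<close> by (simp add: divide_le_eq)
          finally show ?thesis using False \<delta> by (simp add: dist_norm)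
        qed
      qed
    qed
    then have "(?\<phi> \<longlongrightarrow> c a) (nhds a)" by (rule tendstoI)
    then show ?thesis using True by (simp add: isCont_def tendsto_nhds_iff)
  qed
  then show ?thesis by (simp add: continuous_at_imp_continuous_on)
qed

theorem theorem4:
  fixes \<Omega> \<Gamma> :: "(real ^ 'n) set"
    and f g :: "real ^ 'n \<Rightarrow> complex"
  assumes "CARD('n) \<ge> 2"
    and "open \<Omega>"
    and "C1_on \<Omega> f" and "C1_on \<Omega> g"
    and "simple_zeros \<Omega> f" and "simple_zeros \<Omega> g"
    and "\<Gamma> = zero_set \<Omega> f" and "\<Gamma> = zero_set \<Omega> g"
  shows "(\<exists>\<phi> :: real ^ 'n \<Rightarrow> complex.
            continuous_on \<Omega> \<phi> \<and> (\<forall>x\<in>\<Omega>. \<phi> x \<noteq> 0) \<and> (\<forall>x\<in>\<Omega>. f x = g x * \<phi> x))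
         \<longleftrightarrow> complex_linearly_related \<Gamma> f g"
proof -
  obtain f' where f': "\<And>x. x \<in> \<Omega> \<Longrightarrow> (f has_derivative blinfun_apply (f' x)) (at x)"
      "continuous_on \<Omega> f'"
    using \<open>C1_on \<Omega> f\<close> unfolding C1_on_def by blast
  obtain g' where g': "\<And>x. x \<in> \<Omega> \<Longrightarrow> (g has_derivative blinfun_apply (g' x)) (at x)"
      "continuous_on \<Omega> g'"
    using \<open>C1_on \<Omega> g\<close> unfolding C1_on_def by blast
  have \<Gamma>: "x \<in> \<Gamma> \<longleftrightarrow> x \<in> \<Omega> \<and> f x = 0" "x \<in> \<Gamma> \<longleftrightarrow> x \<in> \<Omega> \<and> g x = 0" for x
    using assms(7) by (simp add: zero_set_def) (simp add: assms(8) zero_set_def)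
  have surjf: "surj (blinfun_apply (f' a))" and surjg: "surj (blinfun_apply (g' a))" if "a \<in> \<Gamma>" for a
    using that simple_zeros_surj assms(5-8) f'(1) g'(1) \<Gamma> by metis+
  have right_inverse: "\<exists>R::complex \<Rightarrow>\<^sub>L (real ^ 'n). \<forall>y. g' a (R y) = y" if a: "a \<in> \<Gamma>" for a
  proof -
    have "linear (blinfun_apply (g' a))"
      using blinfun.bounded_linear_right bounded_linear.linear by blast
    then obtain R where "linear R" "blinfun_apply (g' a) \<circ> R = id"
      using linear_surjective_right_inverse surjg[OF a] by blast
    then have "\<forall>y. g' a (Blinfun R y) = y"
      by (simp add: bounded_linear_Blinfun_apply linear_conv_bounded_linear pointfree_idE)
    then show ?thesis by blast
  qed
  have kernel: "f' a w = 0" if a: "a \<in> \<Gamma>" and "g' a w = 0" for a w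
  proof -
    obtain R :: "complex \<Rightarrow>\<^sub>L (real ^ 'n)" where R: "\<And>y. g' a (R y) = y"
      using right_inverse[OF a] by blast
    have "a \<in> \<Omega>" "f a = 0" "g a = 0" using a \<Gamma> by auto
    have "\<forall>\<^sub>F x in nhds a. norm (f x) \<le> (norm (f' a) + 1) * (2 * norm R) * norm (g x)"
      using bounded_by_submersion_with_smaller_zero_set[OF \<open>open \<Omega>\<close> \<open>a \<in> \<Omega>\<close> f' g' _ \<open>g a = 0\<close> R, of 1]
        \<Gamma> by force
    then have "norm (f' a w) \<le> (norm (f' a) + 1) * (2 * norm R) * norm (g' a w)"
      using f'(1) g'(1) \<open>a \<in> \<Omega>\<close> \<open>f a = 0\<close> \<open>g a = 0\<close> derivative_bound_of_function_bound by blast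
    then show ?thesis using \<open>g' a w = 0\<close> by simp
  qed
  have ratio_iff: "deriv_ratio f g a = vector [vector [u, - v], vector [v, u]] \<longleftrightarrow>
      (\<forall>w. f' a w = Complex u v * g' a w)" if a: "a \<in> \<Gamma>" for a u v
  proof -
    have "a \<in> \<Omega>" using a \<Gamma> by blast
    note der = f'(1)[OF this] g'(1)[OF this] surjg[OF a]
    show ?thesis
      using deriv_ratio_works[OF der kernel[OF a]] deriv_ratio_eqI[OF der]
      by (metis complex_mult_as_matrix complex_to_R2_eq_iff)
  qed
  show ?thesis
  proof
    assume "\<exists>\<phi>. continuous_on \<Omega> \<phi> \<and> (\<forall>x\<in>\<Omega>. \<phi> x \<noteq> 0) \<and> (\<forall>x\<in>\<Omega>. f x = g x * \<phi> x)"
    then obtain \<phi> where \<phi>: "continuous_on \<Omega> \<phi>" "\<And>x. x \<in> \<Omega> \<Longrightarrow> f x = g x * \<phi> x" by blast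
    have "f' a w = \<phi> a * g' a w" if a: "a \<in> \<Gamma>" for a w
    proof -
      have "a \<in> \<Omega>" "f a = 0" "g a = 0" using a \<Gamma> by auto
      have "\<forall>\<^sub>F x in nhds a. x \<in> \<Omega>"
        using \<open>open \<Omega>\<close> \<open>a \<in> \<Omega>\<close> by (rule eventually_nhds_in_open)
      then have "\<forall>\<^sub>F x in nhds a. f x = g x * \<phi> x"
        by eventually_elim (rule \<phi>(2))
      moreover have "isCont \<phi> a"
        using \<phi>(1) \<open>open \<Omega>\<close> \<open>a \<in> \<Omega>\<close> by (simp add: continuous_on_eq_continuous_at)
      ultimately show ?thesis
        using derivative_of_continuous_multiple f'(1) g'(1) \<open>a \<in> \<Omega>\<close> \<open>f a = 0\<close> \<open>g a = 0\<close> by blast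
    qed
    then have "\<forall>a\<in>\<Gamma>. deriv_ratio f g a =
        vector [vector [Re (\<phi> a), - Im (\<phi> a)], vector [Im (\<phi> a), Re (\<phi> a)]]"
      by (simp add: ratio_iff)
    then show "complex_linearly_related \<Gamma> f g"
      unfolding complex_linearly_related_def by (intro exI)
  next
    assume "complex_linearly_related \<Gamma> f g"
    then obtain u v where "\<forall>a\<in>\<Gamma>. deriv_ratio f g a = vector [vector [u a, - v a], vector [v a, u a]]"
      unfolding complex_linearly_related_def by blast
    then have c: "f' a w = Complex (u a) (v a) * g' a w" if "a \<in> \<Gamma>" for a w
      using ratio_iff that by blast
    have c_nonzero: "Complex (u a) (v a) \<noteq> 0" if "a \<in> \<Gamma>" for a
    proof
      assume "Complex (u a) (v a) = 0"
      then have "f' a w = 0" for w using c[OF that] by simp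
      then show False using surjf[OF that] by (metis surjD zero_neq_one)
    qed
    \<comment> \<open>The value on the zero set is forced: there \<open>c\<close> is the limit of \<open>f / g\<close>.\<close>
    define \<phi> where "\<phi> = (\<lambda>x. if g x = 0 then Complex (u x) (v x) else f x / g x)"
    have "continuous_on \<Omega> \<phi>"
      unfolding \<phi>_def
      by (rule continuous_quotient_of_linearly_related[OF \<open>open \<Omega>\<close> f' g'])
        (use \<Gamma> right_inverse c in blast)+
    moreover have "\<phi> x \<noteq> 0 \<and> f x = g x * \<phi> x" if "x \<in> \<Omega>" for x
      using that \<Gamma>[of x] c_nonzero[of x] by (auto simp: \<phi>_def)
    ultimately show "\<exists>\<phi>. continuous_on \<Omega> \<phi> \<and> (\<forall>x\<in>\<Omega>. \<phi> x \<noteq> 0) \<and> (\<forall>x\<in>\<Omega>. f x = g x * \<phi> x)"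
      by blast
  qed
qed

end
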